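(* Suppose $n\ge 400$, and $\epsilon_{\max},\alpha\in(0,1)$ are constants satisfying $\overline{q}(\epsilon_{\max})\le 1$. For $\epsilon\in[0,\epsilon_{\max}]$ set $r_\epsilon=\overline{r}(\epsilon)$, let $t_\epsilon$ be the largest element of $$\Big\{t:\ \overline{r}(\epsilon)\le t\le\overline{r}(\epsilon)+F^{-1}(1-\overline{q}(\epsilon)),\ 1-F(t-\overline{r}(\epsilon))-\tfrac{6}{1-\epsilon_{\max}}(1-F(t))\ge 0\Big\},$$ and write $s_\epsilon=\frac32\Big(1-F(t_\epsilon)+\frac{10\log(4/\alpha)}{9n}+\epsilon\Big)$. Then the confidence interval $$\widehat{\mathrm{CI}}=\bigcap_{\epsilon\in[0,\epsilon_{\max}]}\Big[F_n^{-1}(s_\epsilon)+t_\epsilon-r_\epsilon,\ F_n^{-1}(1-s_\epsilon)-t_\epsilon+r_\epsilon\Big]$$ satisfies $$\text{(coverage)}\quad\inf_{\epsilon\in[0,\epsilon_{\max}],\theta,Q}P_{\epsilon,\theta,Q}\big(\theta\in\widehat{\mathrm{CI}}\big)\ge 1-\alpha,$$ $$\text{(length)}\quad\inf_{\epsilon\in[0,\epsilon_{\max}],\theta,Q}P_{\epsilon,\theta,Q}\big(|\widehat{\mathrm{CI}}|\le 2\overline{r}(\epsilon)\big)\ge 1-\alpha.$$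
   Context: Location model: $X\sim P_\theta$ iff $X-\theta\sim P_0$, where $P_0$ is a distribution on $\mathbb{R}$ with a density $f$ that is continuous on its support and symmetric around $0$; $F$ is the CDF of $P_0$. For any CDF $G$, $G^{-1}(q)=\inf\{t\in\mathbb{R}:G(t)\ge q\}$. For $\epsilon\in[0,1]$, $\theta\in\mathbb{R}$ and an arbitrary distribution $Q$ on $\mathbb{R}$, $P_{\epsilon,\theta,Q}=(1-\epsilon)P_\theta+\epsilon Q$; the data are $X_1,\ldots,X_n\overset{iid}{\sim}P_{\epsilon,\theta,Q}$ and $P_{\epsilon,\theta,Q}(\cdot)$ of an event about the data is its probability under this sampling. Infima over $\theta,Q$ are over all $\theta\in\mathbb{R}$ and all probability distributions $Q$ on $\mathbb{R}$. $F_n(t)=\frac1n\sum_{i=1}^n\mathbf{1}\{X_i\le t\}$ is the empirical CDF. An interval $[L,U]$ is empty if $U<L$; $|\cdot|$ is length (Lebesgue measure). For $\epsilon\in[0,\epsilon_{\max}]$ define $$\overline{q}(\epsilon)=\frac{6}{1-\epsilon_{\max}}\left(\epsilon+\frac{100\log(32/\alpha)}{3(1-\epsilon_{\max})n}\right),$$ $$\overline{r}(\epsilon)=\inf\left\{r\ge 0:\ \sup_{r\le t\le r+F^{-1}(1-\overline{q}(\epsilon))}\Big(1-F(t-r)-\frac{6}{1-\epsilon_{\max}}(1-F(t))\Big)\ge 0\right\}.$$ *)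

theory Defs
  imports "HOL-Probability.Probability"
begin

definition location :: "real measure \<Rightarrow> real \<Rightarrow> real measure" where
  "location P0 \<theta> = distr P0 borel (\<lambda>x. x + \<theta>)"

definition mixture :: "real \<Rightarrow> real measure \<Rightarrow> real measure \<Rightarrow> real measure" where
  "mixture \<epsilon> P Q = measure_of UNIV (sets borel)
     (\<lambda>A. ennreal (1 - \<epsilon>) * emeasure P A + ennreal \<epsilon> * emeasure Q A)"

lemma emeasure_mixture:
  assumes "sets P = sets borel" "sets Q = sets borel" "A \<in> sets borel"
  shows "emeasure (mixture \<epsilon> P Q) A = ennreal (1 - \<epsilon>) * emeasure P A + ennreal \<epsilon> * emeasure Q A"
proof -
  let ?\<mu> = "\<lambda>A. ennreal (1 - \<epsilon>) * emeasure P A + ennreal \<epsilon> * emeasure Q A"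
  have "countably_additive (sets borel) ?\<mu>"
  proof (rule countably_additiveI)
    fix B :: "nat \<Rightarrow> real set"
    assume B: "range B \<subseteq> sets borel" "disjoint_family B"
    have "(\<Sum>i. emeasure P (B i)) = emeasure P (\<Union>i. B i)"
         "(\<Sum>i. emeasure Q (B i)) = emeasure Q (\<Union>i. B i)"
      using B assms by (auto intro!: suminf_emeasure)
    then show "(\<Sum>i. ?\<mu> (B i)) = ?\<mu> (\<Union>i. B i)"
      by (simp add: suminf_add[symmetric])
  qed
  moreover have "positive (sets borel) ?\<mu>"
    by (simp add: positive_def)
  moreover have "sigma_algebra UNIV (sets (borel :: real measure))"
    using sets.sigma_algebra_axioms[of "borel :: real measure"] by simp
  ultimately show ?thesis
    unfolding mixture_def using assms(3) by (intro emeasure_measure_of_sigma) auto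
qed

text \<open>The law of \<open>X\<^sub>1, \<dots>, X\<^sub>n\<close>; a sample is a function on \<open>{..<n}\<close>.\<close>

definition sample_law ::
  "real measure \<Rightarrow> nat \<Rightarrow> real \<Rightarrow> real \<Rightarrow> real measure \<Rightarrow> (nat \<Rightarrow> real) measure" where
  "sample_law P0 n \<epsilon> \<theta> Q = PiM {..<n} (\<lambda>_. mixture \<epsilon> (location P0 \<theta>) Q)"

definition ecdf :: "nat \<Rightarrow> (nat \<Rightarrow> real) \<Rightarrow> real \<Rightarrow> real" where
  "ecdf n X t = (\<Sum>i<n. indicator {..t} (X i)) / real n"

definition quantile :: "(real \<Rightarrow> real) \<Rightarrow> real \<Rightarrow> ereal" where
  "quantile G q = Inf (ereal ` {t. G t \<ge> q})"

definition qbar :: "real \<Rightarrow> real \<Rightarrow> nat \<Rightarrow> real \<Rightarrow> real" where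
  "qbar \<epsilon>max \<alpha> n \<epsilon> =
     6 / (1 - \<epsilon>max) * (\<epsilon> + 100 * ln (32 / \<alpha>) / (3 * (1 - \<epsilon>max) * real n))"

text \<open>Infima and suprema are taken in the extended reals. In particular, if
  \<open>F\<^sup>-\<^sup>1(1 - qbar(\<epsilon>)) < 0\<close> (which the condition \<open>qbar(\<epsilon>max) \<le> 1\<close> does not exclude), no \<open>t\<close> is
  admissible for any \<open>r\<close>, the supremum is \<open>-\<infinity>\<close>, and \<open>rbar(\<epsilon>) = \<infinity>\<close>.\<close>

definition rbar :: "(real \<Rightarrow> real) \<Rightarrow> real \<Rightarrow> real \<Rightarrow> nat \<Rightarrow> real \<Rightarrow> ereal" where
  "rbar F \<epsilon>max \<alpha> n \<epsilon> = Inf (ereal ` {r. r \<ge> 0 \<and>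
     (SUP t\<in>{t. r \<le> t \<and> ereal t \<le> ereal r + quantile F (1 - qbar \<epsilon>max \<alpha> n \<epsilon>)}.
        ereal (1 - F (t - r) - 6 / (1 - \<epsilon>max) * (1 - F t))) \<ge> 0})"

definition t_set :: "(real \<Rightarrow> real) \<Rightarrow> real \<Rightarrow> real \<Rightarrow> nat \<Rightarrow> real \<Rightarrow> real set" where
  "t_set F \<epsilon>max \<alpha> n \<epsilon> = {t.
     rbar F \<epsilon>max \<alpha> n \<epsilon> \<le> ereal t \<and>
     ereal t \<le> rbar F \<epsilon>max \<alpha> n \<epsilon> + quantile F (1 - qbar \<epsilon>max \<alpha> n \<epsilon>) \<and>
     1 - F (t - real_of_ereal (rbar F \<epsilon>max \<alpha> n \<epsilon>)) - 6 / (1 - \<epsilon>max) * (1 - F t) \<ge> 0}"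

definition t_eps :: "(real \<Rightarrow> real) \<Rightarrow> real \<Rightarrow> real \<Rightarrow> nat \<Rightarrow> real \<Rightarrow> real" where
  "t_eps F \<epsilon>max \<alpha> n \<epsilon> = (GREATEST t. t \<in> t_set F \<epsilon>max \<alpha> n \<epsilon>)"

definition s_eps :: "(real \<Rightarrow> real) \<Rightarrow> real \<Rightarrow> real \<Rightarrow> nat \<Rightarrow> real \<Rightarrow> real" where
  "s_eps F \<epsilon>max \<alpha> n \<epsilon> =
     3 / 2 * (1 - F (t_eps F \<epsilon>max \<alpha> n \<epsilon>) + 10 * ln (4 / \<alpha>) / (9 * real n) + \<epsilon>)"

text \<open>When \<open>r\<^sub>\<epsilon> = \<infinity>\<close> there is no \<open>t\<^sub>\<epsilon>\<close>; the endpoints, which contain \<open>-r\<^sub>\<epsilon>\<close> and \<open>+r\<^sub>\<epsilon>\<close>, are then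
  read as \<open>-\<infinity>\<close> and \<open>+\<infinity>\<close>, so that this \<open>\<epsilon>\<close> imposes no constraint.\<close>

definition CI_eps ::
  "(real \<Rightarrow> real) \<Rightarrow> real \<Rightarrow> real \<Rightarrow> nat \<Rightarrow> (nat \<Rightarrow> real) \<Rightarrow> real \<Rightarrow> real set" where
  "CI_eps F \<epsilon>max \<alpha> n X \<epsilon> =
     (let r = rbar F \<epsilon>max \<alpha> n \<epsilon>; t = t_eps F \<epsilon>max \<alpha> n \<epsilon>; s = s_eps F \<epsilon>max \<alpha> n \<epsilon> in
      if r = \<infinity> then UNIV
      else {x. quantile (ecdf n X) s + ereal t - r \<le> ereal x \<and>
               ereal x \<le> quantile (ecdf n X) (1 - s) - ereal t + r})"

definition CI ::
  "(real \<Rightarrow> real) \<Rightarrow> real \<Rightarrow> real \<Rightarrow> nat \<Rightarrow> (nat \<Rightarrow> real) \<Rightarrow> real set" where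
  "CI F \<epsilon>max \<alpha> n X = (\<Inter>\<epsilon>\<in>{0..\<epsilon>max}. CI_eps F \<epsilon>max \<alpha> n X \<epsilon>)"

end

theory Submission
  imports Defs
begin

text \<open>Write \<open>u = t\<^sub>\<epsilon> - r\<^sub>\<epsilon>\<close>. By the choice of \<open>r\<^sub>\<epsilon>\<close> and \<open>t\<^sub>\<epsilon>\<close>, \<open>1 - F u\<close> dominates both \<open>qbar(\<epsilon>)\<close> and
  \<open>6 / (1 - \<epsilon>max) (1 - F t\<^sub>\<epsilon>)\<close>, so \<open>s\<^sub>\<epsilon>\<close> is less than half of \<open>(1 - \<epsilon>max)(1 - F u)\<close>, which is a lower
  bound, whatever the contamination, for the probability of a sample point \<open>\<le> \<theta> - u\<close> and of one
  \<open>\<ge> \<theta> + u\<close>. Coverage for all \<open>\<epsilon>\<close> simultaneously therefore follows from a relative lower deviation bound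
  for the empirical tails that is uniform over \<open>u\<close>. For the length only the true \<open>\<epsilon>\<close> matters: an upper
  Chernoff bound shows that fewer than \<open>n s\<^sub>\<epsilon>\<close> points lie on either side of \<open>[\<theta> - t\<^sub>\<epsilon>, \<theta> + t\<^sub>\<epsilon>]\<close>, which puts
  the interval for this \<open>\<epsilon>\<close> inside \<open>[\<theta> - r\<^sub>\<epsilon>, \<theta> + r\<^sub>\<epsilon>]\<close>.\<close>

subsection \<open>Contaminated laws and Chernoff bounds\<close>

lemma sets_mixture [measurable_cong]: "sets (mixture \<epsilon> P Q) = sets borel"
  unfolding mixture_def
  using sets.sets_measure_of_eq[of "borel :: real measure"] by simp

lemma measure_mixture:
  assumes "real_distribution P" "real_distribution Q" "A \<in> sets borel" "0 \<le> \<epsilon>" "\<epsilon> \<le> 1"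
  shows "measure (mixture \<epsilon> P Q) A = (1 - \<epsilon>) * measure P A + \<epsilon> * measure Q A"
proof -
  interpret P: real_distribution P by fact
  interpret Q: real_distribution Q by fact
  have "emeasure (mixture \<epsilon> P Q) A = ennreal ((1 - \<epsilon>) * measure P A + \<epsilon> * measure Q A)"
    using assms
    by (simp add: emeasure_mixture P.emeasure_eq_measure Q.emeasure_eq_measure
        ennreal_mult[symmetric] ennreal_plus[symmetric] del: ennreal_plus)
  then show ?thesis
    using assms by (intro measure_eq_emeasure_eq_ennreal) auto
qed

lemma real_distribution_mixture:
  assumes "real_distribution P" "real_distribution Q" "0 \<le> \<epsilon>" "\<epsilon> \<le> 1"
  shows "real_distribution (mixture \<epsilon> P Q)"
proof -
  interpret P: real_distribution P by fact
  interpret Q: real_distribution Q by fact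
  have sp: "space (mixture \<epsilon> P Q) = UNIV"
    using sets_eq_imp_space_eq[OF sets_mixture] by simp
  have "emeasure (mixture \<epsilon> P Q) UNIV = 1"
    using assms P.emeasure_space_1 Q.emeasure_space_1
    by (simp add: emeasure_mixture ennreal_plus[symmetric] del: ennreal_plus)
  then have "prob_space (mixture \<epsilon> P Q)"
    by (intro prob_spaceI) (simp add: sp)
  then show ?thesis
    by (simp add: real_distribution_def real_distribution_axioms_def sets_mixture)
qed

text \<open>Exponential Markov inequality: the expectation factorises over the independent
  coordinates, and each factor is bounded by \<open>1 + x \<le> exp x\<close>. Since the sign of
  \<open>l\<close> is free, the same estimate serves both tails.\<close>

lemma chernoff_count:
  fixes l c :: real
  assumes "prob_space M" and A [measurable]: "A \<in> sets M"
  shows "measure (PiM {..<n} (\<lambda>_. M))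
      {X \<in> space (PiM {..<n} (\<lambda>_. M)). c \<le> l * (\<Sum>i<n. indicator A (X i))}
    \<le> exp (real n * measure M A * (exp l - 1) - c)"
proof -
  interpret M: prob_space M by fact
  interpret product_prob_space "\<lambda>_. M" "{..<n}" by standard
  let ?P = "PiM {..<n} (\<lambda>_. M)"
  let ?g = "\<lambda>x. exp (l * indicator A x) :: real"
  have g: "?g = (\<lambda>x. 1 + (exp l - 1) * indicator A x)"
    by (auto simp: indicator_def)
  have int_g: "integrable M ?g"
    unfolding g by (simp add: less_top[symmetric])
  have Eg: "integral\<^sup>L M ?g = 1 + (exp l - 1) * measure M A"
    unfolding g by (simp add: less_top[symmetric] M.prob_space)
  have prod: "exp (l * (\<Sum>i<n. indicator A (X i))) = (\<Prod>i<n. ?g (X i))" for X :: "nat \<Rightarrow> 'a"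
    by (simp only: sum_distrib_left exp_sum finite_lessThan)
  have int: "integrable ?P (\<lambda>X. exp (l * (\<Sum>i<n. indicator A (X i))))"
    unfolding prod by (intro product_integrable_prod int_g) simp
  have "integral\<^sup>L ?P (\<lambda>X. exp (l * (\<Sum>i<n. indicator A (X i))))
      = (1 + (exp l - 1) * measure M A) ^ n"
    unfolding prod by (subst product_integral_prod) (simp_all add: int_g Eg)
  also have "\<dots> \<le> exp ((exp l - 1) * measure M A) ^ n"
  proof (rule power_mono[OF exp_ge_add_one_self])
    \<comment> \<open>Raising to the power \<open>n\<close> needs a nonnegative base; this one is
      the expectation of an exponential.\<close>
    show "0 \<le> 1 + (exp l - 1) * measure M A"
      unfolding Eg[symmetric] by simp
  qed
  also have "\<dots> = exp (real n * measure M A * (exp l - 1))"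
    by (simp add: exp_of_nat_mult[symmetric] mult_ac)
  finally have E: "integral\<^sup>L ?P (\<lambda>X. exp (l * (\<Sum>i<n. indicator A (X i))))
      \<le> exp (real n * measure M A * (exp l - 1))" .
  have "measure ?P {X \<in> space ?P. c \<le> l * (\<Sum>i<n. indicator A (X i))}
      = measure ?P {X \<in> space ?P. exp (l * (\<Sum>i<n. indicator A (X i))) \<ge> exp c}"
    by simp
  also have "\<dots> \<le> integral\<^sup>L ?P (\<lambda>X. exp (l * (\<Sum>i<n. indicator A (X i)))) / exp c"
    by (rule integral_Markov_inequality_measure[OF int, of "{}"]) auto
  also have "\<dots> \<le> exp (real n * measure M A * (exp l - 1)) / exp c"
    using E by (intro divide_right_mono) auto
  finally show ?thesis
    by (simp add: exp_diff)
qed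

text \<open>Take \<open>l = - 1 / 4\<close>. As \<open>exp (- 1 / 4) - 1 \<le> - 7 / 32\<close>, the
  exponent is at most \<open>n p (3 / 16 - 7 / 32) = - n p / 32\<close>.\<close>

lemma chernoff_count_lower:
  assumes "prob_space M" "A \<in> sets M" "p \<le> measure M A"
  shows "measure (PiM {..<n} (\<lambda>_. M))
      {X \<in> space (PiM {..<n} (\<lambda>_. M)). (\<Sum>i<n. indicator A (X i)) \<le> 3 / 4 * real n * p}
    \<le> exp (- (real n * p / 32))"
proof -
  interpret M: prob_space M by fact
  \<comment> \<open>The quadratic Taylor polynomial gives 41/32, just above 32/25.\<close>
  have "exp (1 / 4 :: real) \<ge> 32 / 25"
    using exp_lower_Taylor_quadratic[of "1 / 4"] by (simp add: power2_eq_square)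
  then have "inverse (exp (1 / 4 :: real)) \<le> inverse (32 / 25)"
    by (intro le_imp_inverse_le) auto
  then have e: "exp (- 1 / 4 :: real) - 1 \<le> - 7 / 32"
    by (simp add: exp_minus[symmetric])
  have "(exp (- 1 / 4) - 1) * measure M A \<le> - 7 / 32 * measure M A"
    using e by (intro mult_right_mono) auto
  also have "\<dots> \<le> - 7 / 32 * p"
    using assms(3) by simp
  finally have "real n * ((exp (- 1 / 4) - 1) * measure M A) \<le> real n * (- 7 / 32 * p)"
    by (intro mult_left_mono) auto
  then have "real n * measure M A * (exp (- 1 / 4) - 1) - (- (3 / 16 * real n * p)) \<le> - (real n * p / 32)"
    by (simp add: algebra_simps)
  moreover have "{X \<in> space (PiM {..<n} (\<lambda>_. M)). (\<Sum>i<n. indicator A (X i)) \<le> 3 / 4 * real n * p}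
     = {X \<in> space (PiM {..<n} (\<lambda>_. M)). - (3 / 16 * real n * p) \<le> - 1 / 4 * (\<Sum>i<n. indicator A (X i))}"
    by auto
  ultimately show ?thesis
    using chernoff_count[OF assms(1,2), of n "- (3 / 16 * real n * p)" "- 1 / 4"]
    by (smt (verit) exp_le_cancel_iff)
qed

text \<open>Take \<open>l = 3 / 5\<close>. As \<open>exp (3 / 5) - 1 \<le> 9 / 10\<close>, the terms
  in \<open>n p\<close> cancel and \<open>exp (- b)\<close> remains. The threshold is shaped to
  match \<open>n\<close> times \<open>s_eps\<close> when
  \<open>b = ln (4 / \<alpha>)\<close>.\<close>

lemma chernoff_count_upper:
  assumes "prob_space M" "A \<in> sets M" "measure M A \<le> p"
  shows "measure (PiM {..<n} (\<lambda>_. M))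
      {X \<in> space (PiM {..<n} (\<lambda>_. M)). 3 / 2 * (real n * p + 10 / 9 * b) \<le> (\<Sum>i<n. indicator A (X i))}
    \<le> exp (- b)"
proof -
  interpret M: prob_space M by fact
  have "exp (- 1 / 10 :: real) \<ge> 9 / 10"
    using exp_ge_add_one_self[of "- 1 / 10"] by simp
  then have "(9 / 10) ^ 6 \<le> exp (- 1 / 10 :: real) ^ 6"
    by (intro power_mono) auto
  also have "\<dots> = inverse (exp (3 / 5))"
    by (simp add: exp_of_nat_mult[symmetric] exp_minus[symmetric])
  finally have "inverse (inverse (exp (3 / 5 :: real))) \<le> inverse ((9 / 10) ^ 6)"
    by (intro le_imp_inverse_le) auto
  then have e: "exp (3 / 5 :: real) - 1 \<le> 9 / 10"
    by (simp add: eval_nat_numeral)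
  have "measure M A * (exp (3 / 5) - 1) \<le> measure M A * (9 / 10)"
    using e by (intro mult_left_mono) auto
  also have "\<dots> \<le> p * (9 / 10)"
    using assms(3) by simp
  finally have "real n * (measure M A * (exp (3 / 5) - 1)) \<le> real n * (p * (9 / 10))"
    by (intro mult_left_mono) auto
  then have "real n * measure M A * (exp (3 / 5) - 1) - 9 / 10 * (real n * p + 10 / 9 * b) \<le> - b"
    by (simp add: algebra_simps)
  moreover have "{X \<in> space (PiM {..<n} (\<lambda>_. M)). 3 / 2 * (real n * p + 10 / 9 * b) \<le> (\<Sum>i<n. indicator A (X i))}
     = {X \<in> space (PiM {..<n} (\<lambda>_. M)). 9 / 10 * (real n * p + 10 / 9 * b) \<le> 3 / 5 * (\<Sum>i<n. indicator A (X i))}"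
    by auto
  ultimately show ?thesis
    using chernoff_count[OF assms(1,2), of n "9 / 10 * (real n * p + 10 / 9 * b)" "3 / 5"]
    by (smt (verit) exp_le_cancel_iff)
qed

subsection \<open>Quantiles and measurability of the confidence interval\<close>

text \<open>Monotonicity makes the superlevel set of \<open>G\<close> upward closed. Testing only
  points strictly right of \<open>x\<close> avoids asking whether the infimum is attained, and by
  density rational points suffice; this countability serves measurability.\<close>

lemma quantile_le_iff:
  assumes "mono G"
  shows "quantile G q \<le> ereal x \<longleftrightarrow> (\<forall>y\<in>\<rat>. x < y \<longrightarrow> q \<le> G y)"
proof safe
  fix y assume "quantile G q \<le> ereal x" "x < y"
  then have "quantile G q < ereal y"
    by (simp add: order_le_less_trans)
  then obtain t where "t < y" "q \<le> G t"
    unfolding quantile_def Inf_less_iff by auto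
  then show "q \<le> G y"
    using monoD[OF assms, of t y] by simp
next
  assume R: "\<forall>y\<in>\<rat>. x < y \<longrightarrow> q \<le> G y"
  show "quantile G q \<le> ereal x"
  proof (rule ccontr)
    assume "\<not> quantile G q \<le> ereal x"
    then have "ereal x < quantile G q"
      by simp
    then obtain z where z: "x < z" "ereal z < quantile G q"
      using ereal_dense2 by (metis less_ereal.simps(1))
    obtain y where y: "y \<in> \<rat>" "x < y" "y < z"
      using Rats_dense_in_real[OF z(1)] by blast
    then have "quantile G q \<le> ereal y"
      using R unfolding quantile_def by (auto intro: Inf_lower)
    then have "ereal z < ereal y"
      using z(2) by (rule less_le_trans[rotated])
    then show False
      using y by simp
  qed
qed

lemma le_quantile_iff:
  assumes "mono G"
  shows "ereal x \<le> quantile G q \<longleftrightarrow> (\<forall>y\<in>\<rat>. y < x \<longrightarrow> G y < q)"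
proof safe
  fix y assume "ereal x \<le> quantile G q" "y < x"
  then have "\<not> quantile G q \<le> ereal y"
    by (metis dual_order.strict_trans1 less_ereal.simps(1) not_less)
  then show "G y < q"
    unfolding quantile_def by (metis (mono_tags, lifting) Inf_lower imageI mem_Collect_eq not_less)
next
  assume R: "\<forall>y\<in>\<rat>. y < x \<longrightarrow> G y < q"
  have "x \<le> t" if t: "q \<le> G t" for t
  proof (rule ccontr)
    assume "\<not> x \<le> t"
    then obtain y where "y \<in> \<rat>" "t < y" "y < x"
      using Rats_dense_in_real[of t x] by auto
    then show False
      using R t monoD[OF assms, of t y] by fastforce
  qed
  then show "ereal x \<le> quantile G q"
    unfolding quantile_def by (auto intro: Inf_greatest)
qed

lemma mono_ecdf: "mono (ecdf n X)"
  unfolding ecdf_def by (intro monoI divide_right_mono sum_mono) (auto simp: indicator_def)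

lemma measurable_ecdf [measurable]:
  assumes "sets M = sets borel"
  shows "(\<lambda>X. ecdf n X y) \<in> borel_measurable (PiM {..<n} (\<lambda>_. M))"
proof -
  note assms [measurable_cong]
  show ?thesis
    unfolding ecdf_def by measurable
qed

text \<open>The two endpoints for a given \<epsilon> depend on \<open>t_eps\<close> and
  \<open>rbar\<close> only through their difference \<open>u\<close>. Infinite radii impose no
  constraint and are left out, so \<open>real_of_ereal\<close> is applied to finite values
  only.\<close>

definition CI_constraints ::
  "(real \<Rightarrow> real) \<Rightarrow> real \<Rightarrow> real \<Rightarrow> nat \<Rightarrow> (real \<times> real) set" where
  "CI_constraints F \<epsilon>max \<alpha> n =
     {(t_eps F \<epsilon>max \<alpha> n \<epsilon> - real_of_ereal (rbar F \<epsilon>max \<alpha> n \<epsilon>), s_eps F \<epsilon>max \<alpha> n \<epsilon>) | \<epsilon>.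
        \<epsilon> \<in> {0..\<epsilon>max} \<and> rbar F \<epsilon>max \<alpha> n \<epsilon> \<noteq> \<infinity>}"

lemma rbar_nonneg: "0 \<le> rbar F \<epsilon>max \<alpha> n \<epsilon>"
  unfolding rbar_def by (auto intro: Inf_greatest)

text \<open>An empirical quantile may be infinite, so the finite shift is moved to the real side of
  each inequality.\<close>

lemma mem_CI_eps_iff:
  assumes "rbar F \<epsilon>max \<alpha> n \<epsilon> = ereal r"
  shows "x \<in> CI_eps F \<epsilon>max \<alpha> n X \<epsilon> \<longleftrightarrow>
    quantile (ecdf n X) (s_eps F \<epsilon>max \<alpha> n \<epsilon>) \<le> ereal (x - (t_eps F \<epsilon>max \<alpha> n \<epsilon> - r)) \<and>
    ereal (x + (t_eps F \<epsilon>max \<alpha> n \<epsilon> - r)) \<le> quantile (ecdf n X) (1 - s_eps F \<epsilon>max \<alpha> n \<epsilon>)"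
proof -
  have "a + ereal t - ereal r \<le> ereal x \<longleftrightarrow> a \<le> ereal (x - (t - r))" for a t
    by (cases a) auto
  moreover have "ereal x \<le> a - ereal t + ereal r \<longleftrightarrow> ereal (x + (t - r)) \<le> a" for a t
    by (cases a) auto
  ultimately show ?thesis
    unfolding CI_eps_def Let_def assms by simp
qed

lemma mem_CI_iff:
  "x \<in> CI F \<epsilon>max \<alpha> n X \<longleftrightarrow> (\<forall>(u, s)\<in>CI_constraints F \<epsilon>max \<alpha> n.
     quantile (ecdf n X) s \<le> ereal (x - u) \<and> ereal (x + u) \<le> quantile (ecdf n X) (1 - s))"
proof -
  have "x \<in> CI_eps F \<epsilon>max \<alpha> n X \<epsilon> \<longleftrightarrow> (rbar F \<epsilon>max \<alpha> n \<epsilon> \<noteq> \<infinity> \<longrightarrow>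
      quantile (ecdf n X) (s_eps F \<epsilon>max \<alpha> n \<epsilon>)
        \<le> ereal (x - (t_eps F \<epsilon>max \<alpha> n \<epsilon> - real_of_ereal (rbar F \<epsilon>max \<alpha> n \<epsilon>))) \<and>
      ereal (x + (t_eps F \<epsilon>max \<alpha> n \<epsilon> - real_of_ereal (rbar F \<epsilon>max \<alpha> n \<epsilon>)))
        \<le> quantile (ecdf n X) (1 - s_eps F \<epsilon>max \<alpha> n \<epsilon>))" for \<epsilon>
  proof (cases "rbar F \<epsilon>max \<alpha> n \<epsilon>")
    case (real r)
    then show ?thesis by (simp add: mem_CI_eps_iff)
  next
    case PInf
    then show ?thesis by (simp add: CI_eps_def)
  next
    case MInf
    then show ?thesis using rbar_nonneg[of F \<epsilon>max \<alpha> n \<epsilon>] by simp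
  qed
  then have "x \<in> CI F \<epsilon>max \<alpha> n X \<longleftrightarrow> (\<forall>\<epsilon>\<in>{0..\<epsilon>max}. rbar F \<epsilon>max \<alpha> n \<epsilon> \<noteq> \<infinity> \<longrightarrow>
      quantile (ecdf n X) (s_eps F \<epsilon>max \<alpha> n \<epsilon>)
        \<le> ereal (x - (t_eps F \<epsilon>max \<alpha> n \<epsilon> - real_of_ereal (rbar F \<epsilon>max \<alpha> n \<epsilon>))) \<and>
      ereal (x + (t_eps F \<epsilon>max \<alpha> n \<epsilon> - real_of_ereal (rbar F \<epsilon>max \<alpha> n \<epsilon>)))
        \<le> quantile (ecdf n X) (1 - s_eps F \<epsilon>max \<alpha> n \<epsilon>))"
    unfolding CI_def by simp
  then show ?thesis
    unfolding CI_constraints_def by blast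
qed

text \<open>Convexity makes the set Borel and lets its length be read off from pairs of its
  points.\<close>

lemma is_interval_CI: "is_interval (CI F \<epsilon>max \<alpha> n X)"
  unfolding is_interval_1
proof (intro ballI allI impI)
  fix a b x
  assume a: "a \<in> CI F \<epsilon>max \<alpha> n X" and b: "b \<in> CI F \<epsilon>max \<alpha> n X" and x: "a \<le> x \<and> x \<le> b"
  have "quantile (ecdf n X) s \<le> ereal (x - u) \<and> ereal (x + u) \<le> quantile (ecdf n X) (1 - s)"
    if "(u, s) \<in> CI_constraints F \<epsilon>max \<alpha> n" for u s
  proof
    have "quantile (ecdf n X) s \<le> ereal (a - u)" "ereal (b + u) \<le> quantile (ecdf n X) (1 - s)"
      using a b that unfolding mem_CI_iff by auto
    then show "quantile (ecdf n X) s \<le> ereal (x - u)" "ereal (x + u) \<le> quantile (ecdf n X) (1 - s)"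
      using x order_trans[of "quantile (ecdf n X) s" "ereal (a - u)" "ereal (x - u)"]
        order_trans[of "ereal (x + u)" "ereal (b + u)" "quantile (ecdf n X) (1 - s)"]
      by simp_all
  qed
  then show "x \<in> CI F \<epsilon>max \<alpha> n X"
    unfolding mem_CI_iff by auto
qed

text \<open>\<open>CI\<close> is an uncountable intersection. After restricting the comparison points \<open>y\<close> to the
  rationals, the uncountably many \<open>\<epsilon>\<close> only say, for each \<open>y\<close>, that the real number \<open>ecdf n X y\<close>
  lies in a certain interval.\<close>

lemma measurable_mem_CI:
  assumes "sets M = sets borel"
  shows "{X \<in> space (PiM {..<n} (\<lambda>_. M)). x \<in> CI F \<epsilon>max \<alpha> n X} \<in> sets (PiM {..<n} (\<lambda>_. M))"
proof -
  let ?P = "PiM {..<n} (\<lambda>_. M)" and ?C = "CI_constraints F \<epsilon>max \<alpha> n"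
  define I where "I y = {v. \<forall>(u, s)\<in>?C. (x - u < y \<longrightarrow> s \<le> v) \<and> (y < x + u \<longrightarrow> v < 1 - s)}" for y
  have "is_interval (I y)" for y
    unfolding is_interval_1 I_def by (auto; blast intro: order_trans le_less_trans)
  then have [measurable]: "I y \<in> sets borel" for y
    by (rule real_interval_borel_measurable)
  have [measurable]: "(\<lambda>X. ecdf n X y) \<in> borel_measurable ?P" for y
    by (rule measurable_ecdf[OF assms])
  have "x \<in> CI F \<epsilon>max \<alpha> n X \<longleftrightarrow> (\<forall>y\<in>\<rat>. ecdf n X y \<in> I y)" for X
    unfolding mem_CI_iff quantile_le_iff[OF mono_ecdf] le_quantile_iff[OF mono_ecdf] I_def
    by blast
  moreover have "{X \<in> space ?P. \<forall>y\<in>\<rat>. ecdf n X y \<in> I y} \<in> sets ?P"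
    by (intro sets.sets_Collect_countable_All' countable_rat) measurable
  ultimately show ?thesis
    by simp
qed

text \<open>The length of an interval is its diameter, which rational points already detect. This
  makes a length bound a countable condition.\<close>

lemma emeasure_interval_le_iff:
  fixes S :: "real set"
  assumes S: "is_interval S" and "0 \<le> d"
  shows "emeasure lborel S \<le> ennreal d \<longleftrightarrow> (\<forall>a\<in>\<rat>. \<forall>b\<in>\<rat>. a \<in> S \<longrightarrow> b \<in> S \<longrightarrow> b - a \<le> d)"
proof (intro iffI ballI impI)
  fix a b assume le: "emeasure lborel S \<le> ennreal d" and ab: "a \<in> S" "b \<in> S"
  show "b - a \<le> d"
  proof (cases "a \<le> b")
    case True
    have "{a..b} \<subseteq> S"
      using S ab unfolding is_interval_1 by (meson atLeastAtMost_iff subsetI)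
    then have "ennreal (b - a) \<le> emeasure lborel S"
      using emeasure_mono[of "{a..b}" S lborel] real_interval_borel_measurable[OF S] True by simp
    then show ?thesis
      using le assms(2) by (metis ennreal_le_iff order_trans)
  qed (use assms in simp)
next
  assume R: "\<forall>a\<in>\<rat>. \<forall>b\<in>\<rat>. a \<in> S \<longrightarrow> b \<in> S \<longrightarrow> b - a \<le> d"
  \<comment> \<open>If two points were more than \<open>d\<close> apart, moving each inwards to a
    rational by less than half the excess would leave a rational pair in \<open>S\<close> still more
    than \<open>d\<close> apart.\<close>
  have d: "b - a \<le> d" if "a \<in> S" "b \<in> S" for a b
  proof (rule ccontr)
    assume "\<not> b - a \<le> d"
    then have h: "0 < (b - a - d) / 2"
      by simp
    obtain a' where a': "a' \<in> \<rat>" "a < a'" "a' < a + (b - a - d) / 2"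
      using Rats_dense_in_real[of a "a + (b - a - d) / 2"] h by auto
    obtain b' where b': "b' \<in> \<rat>" "b - (b - a - d) / 2 < b'" "b' < b"
      using Rats_dense_in_real[of "b - (b - a - d) / 2" b] h by auto
    have "b' - a' > d"
      using a' b' by (simp add: field_simps)
    then have "a' \<le> b" "a \<le> b'"
      using a' b' assms(2) by auto
    then have "a' \<in> S" "b' \<in> S"
      using S that a' b' unfolding is_interval_1 by (meson less_imp_le)+
    then show False
      using R a' b' \<open>b' - a' > d\<close> by fastforce
  qed
  show "emeasure lborel S \<le> ennreal d"
  proof (cases "S = {}")
    case False
    then obtain b where b: "b \<in> S" by auto
    have bdd: "bdd_below S"
      using d[OF _ b] by (intro bdd_belowI[of _ "b - d"]) (auto simp: algebra_simps)
    have "S \<subseteq> {Inf S..Inf S + d}"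
    proof
      fix x assume x: "x \<in> S"
      then have "x - d \<le> Inf S"
        using d[OF _ x] by (intro cInf_greatest) (auto simp: algebra_simps)
      then show "x \<in> {Inf S..Inf S + d}"
        using cInf_lower[OF x bdd] by simp
    qed
    then have "emeasure lborel S \<le> emeasure lborel {Inf S..Inf S + d}"
      by (intro emeasure_mono) auto
    then show ?thesis
      using assms(2) by simp
  qed simp
qed

lemma measurable_length_CI:
  assumes "sets M = sets borel" "0 \<le> d"
  shows "{X \<in> space (PiM {..<n} (\<lambda>_. M)). emeasure lborel (CI F \<epsilon>max \<alpha> n X) \<le> ennreal d}
    \<in> sets (PiM {..<n} (\<lambda>_. M))"
proof -
  have [measurable]: "Measurable.pred (PiM {..<n} (\<lambda>_. M)) (\<lambda>X. x \<in> CI F \<epsilon>max \<alpha> n X)" for x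
    using measurable_mem_CI[OF assms(1)] by (simp add: pred_def)
  show ?thesis
    unfolding emeasure_interval_le_iff[OF is_interval_CI assms(2)]
    by (intro sets.sets_Collect_countable_All' countable_rat) measurable
qed

subsection \<open>Attainment of the radius and the largest threshold\<close>

lemma measure_location: "real_distribution P0 \<Longrightarrow> A \<in> sets borel \<Longrightarrow>
    measure (location P0 \<theta>) A = measure P0 {x. x + \<theta> \<in> A}"
  unfolding location_def real_distribution_def real_distribution_axioms_def
  by (subst measure_distr)
    (auto simp: vimage_def dest: sets_eq_imp_space_eq cong: measurable_cong_sets)

text \<open>Strictly left of the quantile \<open>G\<close> stays below \<open>q\<close>; continuity
  carries the weak inequality to the quantile itself.\<close>

lemma le_of_le_quantile:
  assumes G: "\<And>x. isCont G x" and z: "quantile G q = ereal z" and "u \<le> z"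
  shows "G u \<le> q"
proof -
  have lt: "G y < q" if "y < z" for y
  proof (rule ccontr)
    assume "\<not> G y < q"
    then have "quantile G q \<le> ereal y"
      unfolding quantile_def by (auto intro: Inf_lower)
    then show False
      using z that by simp
  qed
  have "(G \<longlongrightarrow> G z) (at_left z)"
    using G[of z] by (simp add: isCont_def filterlim_at_split)
  moreover have "eventually (\<lambda>y. G y \<le> q) (at_left z)"
    using lt by (auto simp: eventually_at_left_field intro!: exI[of _ "z - 1"] less_imp_le)
  ultimately have "G z \<le> q"
    by (intro tendsto_upperbound[of G _ "at_left z"]) auto
  then show ?thesis
    using lt[of u] \<open>u \<le> z\<close> by (cases "u = z") auto
qed

text \<open>The infimum defining \<open>rbar\<close> and the maximum defining \<open>t_eps\<close> are attained because \<open>F\<close> is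
  continuous and the parameters range over compact sets.\<close>

lemma t_eps_mem:
  assumes cont: "\<And>x. isCont F x" and lim: "(F \<longlongrightarrow> 1) at_top"
    and q: "0 < qbar \<epsilon>max \<alpha> n \<epsilon>" and r: "rbar F \<epsilon>max \<alpha> n \<epsilon> \<noteq> \<infinity>"
  shows "t_eps F \<epsilon>max \<alpha> n \<epsilon> \<in> t_set F \<epsilon>max \<alpha> n \<epsilon>"
    and "\<exists>z\<ge>0. quantile F (1 - qbar \<epsilon>max \<alpha> n \<epsilon>) = ereal z"
proof -
  define c where "c = 6 / (1 - \<epsilon>max)"
  define \<phi> where "\<phi> r t = 1 - F (t - r) - c * (1 - F t)" for r t
  let ?Z = "quantile F (1 - qbar \<epsilon>max \<alpha> n \<epsilon>)"
  let ?T = "\<lambda>r. {t. r \<le> t \<and> ereal t \<le> ereal r + ?Z}"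
  let ?R = "{r. r \<ge> 0 \<and> (SUP t\<in>?T r. ereal (\<phi> r t)) \<ge> 0}"
  have rbar: "rbar F \<epsilon>max \<alpha> n \<epsilon> = Inf (ereal ` ?R)"
    unfolding rbar_def \<phi>_def c_def ..
  have [continuous_intros]: "continuous_on S (\<lambda>x. F (g x))"
    if "continuous_on S g" for S :: "'b::topological_space set" and g
    using continuous_on_compose2[OF continuous_at_imp_continuous_on[of UNIV F] that] cont by auto
  \<comment> \<open>A finite radius yields an admissible \<open>r1\<close>. Its range of
    \<open>t\<close> is nonempty, because an empty supremum is \<open>- \<infinity>\<close>; hence
    the quantile is nonnegative.\<close>
  have "?R \<noteq> {}"
    using r unfolding rbar by (metis image_empty Inf_empty top_ereal_def)
  then obtain r1 where r1: "r1 \<in> ?R" by blast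
  have "?T r1 \<noteq> {}"
  proof
    assume "?T r1 = {}"
    then have "(SUP t\<in>?T r1. ereal (\<phi> r1 t)) = - \<infinity>"
      by (simp only: image_empty Sup_empty bot_ereal_def)
    then show False using r1 by simp
  qed
  then have Z0: "0 \<le> ?Z"
    by (cases ?Z) auto
  \<comment> \<open>Since \<open>qbar\<close> is positive, \<open>F\<close> exceeds the level
    somewhere, so the quantile is not \<open>\<infinity>\<close>.\<close>
  have "eventually (\<lambda>t. F t > 1 - qbar \<epsilon>max \<alpha> n \<epsilon>) at_top"
    using order_tendstoD(1)[OF lim] q by simp
  then obtain t0 where "1 - qbar \<epsilon>max \<alpha> n \<epsilon> < F t0"
    by (meson eventually_at_top_linorder order_refl)
  then have "?Z \<le> ereal t0"
    unfolding quantile_def by (intro Inf_lower) auto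
  then obtain z where z: "?Z = ereal z" "0 \<le> z"
    using Z0 by (cases ?Z) auto
  then show "\<exists>z\<ge>0. ?Z = ereal z"
    by blast
  have T: "?T r = {r..r + z}" for r
    using z by auto
  have R: "r \<in> ?R \<longleftrightarrow> 0 \<le> r \<and> (\<exists>t\<in>{r..r + z}. 0 \<le> \<phi> r t)" for r
  proof -
    have "continuous_on {r..r + z} (\<phi> r)"
      unfolding \<phi>_def by (intro continuous_intros)
    then obtain t where t: "t \<in> {r..r + z}" "\<And>t'. t' \<in> {r..r + z} \<Longrightarrow> \<phi> r t' \<le> \<phi> r t"
      using continuous_attains_sup[of "{r..r + z}" "\<phi> r"] z by auto
    then have "(SUP t\<in>{r..r + z}. ereal (\<phi> r t)) = ereal (\<phi> r t)"
      by (intro antisym SUP_least SUP_upper) auto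
    then show ?thesis
      using t unfolding T mem_Collect_eq by (auto intro: order_trans)
  qed
  \<comment> \<open>The coordinates \<open>(r, t - r)\<close> turn the moving range of
    \<open>t\<close> into a fixed box, and cutting at \<open>r1\<close> bounds \<open>r\<close>. The
    least element of the compact projection of \<open>K\<close> is then the radius.\<close>
  define K where "K = ({0..r1} \<times> {0..z}) \<inter> {p. 0 \<le> \<phi> (fst p) (fst p + snd p)}"
  have "closed {p :: real \<times> real. 0 \<le> \<phi> (fst p) (fst p + snd p)}"
    unfolding \<phi>_def by (intro closed_Collect_le continuous_intros)
  then have "compact K"
    unfolding K_def by (intro compact_Int_closed compact_Times) auto
  then have "compact (fst ` K)"
    by (intro compact_continuous_image continuous_intros)
  moreover obtain t1 where t1: "t1 \<in> {r1..r1 + z}" "0 \<le> \<phi> r1 t1" "0 \<le> r1"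
    using r1 R by blast
  then have "(r1, t1 - r1) \<in> K"
    unfolding K_def by simp
  then have r1K: "r1 \<in> fst ` K"
    by force
  ultimately obtain rs where rs: "rs \<in> fst ` K" "\<And>r'. r' \<in> fst ` K \<Longrightarrow> rs \<le> r'"
    using compact_attains_inf[of "fst ` K"] by blast
  then obtain v where v: "0 \<le> v" "v \<le> z" "0 \<le> \<phi> rs (rs + v)" "0 \<le> rs"
    unfolding K_def by auto
  then have rsR: "rs \<in> ?R"
    unfolding R by (auto intro!: bexI[of _ "rs + v"])
  have "rs \<le> r'" if r': "r' \<in> ?R" for r'
  proof (cases "r' \<le> r1")
    case True
    obtain t where "t \<in> {r'..r' + z}" "0 \<le> \<phi> r' t" "0 \<le> r'"
      using r' R by blast
    then have "(r', t - r') \<in> K"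
      using True unfolding K_def by simp
    then show ?thesis using rs(2) by force
  next
    case False
    then show ?thesis using rs(2)[OF r1K] by simp
  qed
  then have rbar': "rbar F \<epsilon>max \<alpha> n \<epsilon> = ereal rs"
    unfolding rbar using rsR by (intro antisym Inf_lower Inf_greatest) auto
  have ts: "t_set F \<epsilon>max \<alpha> n \<epsilon> = {rs..rs + z} \<inter> {t. 0 \<le> \<phi> rs t}"
    unfolding t_set_def rbar' z \<phi>_def c_def by auto
  have "closed {t. 0 \<le> \<phi> rs t}"
    unfolding \<phi>_def by (intro closed_Collect_le continuous_intros)
  then have "compact (t_set F \<epsilon>max \<alpha> n \<epsilon>)"
    unfolding ts by (intro compact_Int_closed) auto
  moreover have "rs + v \<in> t_set F \<epsilon>max \<alpha> n \<epsilon>"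
    unfolding ts using v by simp
  ultimately obtain t where "t \<in> t_set F \<epsilon>max \<alpha> n \<epsilon>" "\<And>t'. t' \<in> t_set F \<epsilon>max \<alpha> n \<epsilon> \<Longrightarrow> t' \<le> t"
    using compact_attains_sup[of "t_set F \<epsilon>max \<alpha> n \<epsilon>"] by blast
  then show "t_eps F \<epsilon>max \<alpha> n \<epsilon> \<in> t_set F \<epsilon>max \<alpha> n \<epsilon>"
    unfolding t_eps_def by (rule GreatestI2_order)
qed

text \<open>The upper end of the range of \<open>t\<close> says that \<open>t - r\<close> is at most
  the quantile; \<open>le_of_le_quantile\<close> turns this into a lower bound on the tail beyond
  \<open>t - r\<close>.\<close>

lemma t_eps_bounds:
  assumes cont: "\<And>x. isCont F x" and lim: "(F \<longlongrightarrow> 1) at_top"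
    and q: "0 < qbar \<epsilon>max \<alpha> n \<epsilon>" and r: "rbar F \<epsilon>max \<alpha> n \<epsilon> = ereal r"
  shows "r \<le> t_eps F \<epsilon>max \<alpha> n \<epsilon>"
    and "qbar \<epsilon>max \<alpha> n \<epsilon> \<le> 1 - F (t_eps F \<epsilon>max \<alpha> n \<epsilon> - r)"
    and "6 / (1 - \<epsilon>max) * (1 - F (t_eps F \<epsilon>max \<alpha> n \<epsilon>)) \<le> 1 - F (t_eps F \<epsilon>max \<alpha> n \<epsilon> - r)"
proof -
  have "rbar F \<epsilon>max \<alpha> n \<epsilon> \<noteq> \<infinity>"
    using r by simp
  note * = t_eps_mem[OF cont lim q this]
  obtain z where z: "quantile F (1 - qbar \<epsilon>max \<alpha> n \<epsilon>) = ereal z"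
    using *(2) by blast
  have t: "r \<le> t_eps F \<epsilon>max \<alpha> n \<epsilon>" "t_eps F \<epsilon>max \<alpha> n \<epsilon> - r \<le> z"
    "6 / (1 - \<epsilon>max) * (1 - F (t_eps F \<epsilon>max \<alpha> n \<epsilon>)) \<le> 1 - F (t_eps F \<epsilon>max \<alpha> n \<epsilon> - r)"
    using *(1) unfolding t_set_def r z by auto
  show "r \<le> t_eps F \<epsilon>max \<alpha> n \<epsilon>"
    "6 / (1 - \<epsilon>max) * (1 - F (t_eps F \<epsilon>max \<alpha> n \<epsilon>)) \<le> 1 - F (t_eps F \<epsilon>max \<alpha> n \<epsilon> - r)"
    by fact+
  show "qbar \<epsilon>max \<alpha> n \<epsilon> \<le> 1 - F (t_eps F \<epsilon>max \<alpha> n \<epsilon> - r)"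
    using le_of_le_quantile[OF cont z t(2)] by simp
qed

text \<open>A density excludes atoms, so the cdf is continuous and open and closed half-lines have
  equal mass. Reflection through 0 gives the left tails.\<close>

lemma symmetric_density_tails:
  assumes "real_distribution P0"
    and f_meas [measurable]: "f \<in> borel_measurable borel"
    and P0_density: "P0 = density lborel (\<lambda>x. ennreal (f x))"
    and f_sym: "\<And>x. f (- x) = f x"
  shows "isCont (cdf P0) x"
    and "measure P0 {x..} = 1 - cdf P0 x" and "measure P0 {x<..} = 1 - cdf P0 x"
    and "measure P0 {..-x} = 1 - cdf P0 x" and "measure P0 {..<-x} = 1 - cdf P0 x"
proof -
  interpret real_distribution P0 by fact
  have "emeasure P0 {y} = 0" for y
    unfolding P0_density
    by (subst emeasure_density) (auto simp: nn_integral_indicator_singleton)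
  then have atom: "measure P0 {y} = 0" for y
    by (simp add: measure_def)
  then show "isCont (cdf P0) x"
    by (simp add: isCont_cdf)
  show gt: "measure P0 {x<..} = 1 - cdf P0 x" for x
    using prob_compl[of "{..x}"] by (simp add: cdf_def Compl_eq_Diff_UNIV[symmetric])
  show ge: "measure P0 {x..} = 1 - cdf P0 x" for x
  proof -
    have "{x..} = {x} \<union> {x<..}" by auto
    then have "measure P0 {x..} = measure P0 {x} + measure P0 {x<..}"
      by (simp only:) (intro finite_measure_Union; auto)
    then show ?thesis using gt atom by simp
  qed
  have neg: "measure P0 {y. - y \<in> A} = measure P0 A" if [measurable]: "A \<in> sets borel" for A
  proof -
    have "emeasure P0 A = (\<integral>\<^sup>+y. ennreal (f y) * indicator A y \<partial>lborel)"
      unfolding P0_density by (subst emeasure_density) auto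
    also have "\<dots> = (\<integral>\<^sup>+y. ennreal (f y) * indicator A (- y) \<partial>lborel)"
      by (subst nn_integral_real_affine[where c = "-1" and t = 0]) (auto simp: f_sym)
    also have "\<dots> = (\<integral>\<^sup>+y. ennreal (f y) * indicator {y. - y \<in> A} y \<partial>lborel)"
      by (simp add: indicator_def)
    also have "\<dots> = emeasure P0 {y. - y \<in> A}"
      unfolding P0_density by (subst emeasure_density) auto
    finally show ?thesis by (simp add: measure_def)
  qed
  have "{y. - y \<in> {x..}} = {..-x}" "{y. - y \<in> {x<..}} = {..<-x}"
    by auto
  then show "measure P0 {..-x} = 1 - cdf P0 x" "measure P0 {..<-x} = 1 - cdf P0 x"
    using neg[of "{x..}"] neg[of "{x<..}"] ge gt by simp_all
qed

subsection \<open>Uniform lower bound for empirical tails\<close>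

lemma (in prob_space) prob_ge_if_compl_subset:
  assumes "B \<in> events" "E \<in> events" "space M - B \<subseteq> E" "prob B \<le> a"
  shows "1 - a \<le> prob E"
proof -
  have "1 - a \<le> prob (space M - B)"
    using assms by (simp add: prob_compl)
  also have "\<dots> \<le> prob E"
    using assms by (intro finite_measure_mono) auto
  finally show ?thesis .
qed

text \<open>Peeling: by monotonicity in \<open>u\<close> it suffices to control the counts at points \<open>x k\<close> where \<open>h\<close>
  takes the values \<open>a (3/2)\<^sup>k\<close>, and the Chernoff bounds at these points are summable.\<close>

lemma uniform_count_lower_bound:
  fixes h :: "real \<Rightarrow> real" and A :: "real \<Rightarrow> 'a set"
  assumes M: "prob_space M" and A: "\<And>u. A u \<in> sets M"
    and A_anti: "\<And>u v. u \<le> v \<Longrightarrow> A v \<subseteq> A u"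
    and h_le: "\<And>u. h u \<le> measure M (A u)"
    and h_anti: "\<And>u v. u \<le> v \<Longrightarrow> h v \<le> h u"
    and h_cont: "\<And>u. isCont h u" and h_lim: "(h \<longlongrightarrow> 0) at_top"
    and n: "0 < n" and b: "0 < b" "exp (- b) \<le> 1 / 2"
  shows "\<exists>B\<in>sets (PiM {..<n} (\<lambda>_. M)). measure (PiM {..<n} (\<lambda>_. M)) B \<le> 2 * exp (- b) \<and>
    (\<forall>X\<in>space (PiM {..<n} (\<lambda>_. M)) - B. \<forall>u. 100 * b / real n < h u \<longrightarrow>
       real n * h u / 2 < (\<Sum>i<n. indicator (A u) (X i)))"
proof -
  interpret M: prob_space M by fact
  interpret product_prob_space "\<lambda>_. M" "{..<n}" by standard
  let ?P = "PiM {..<n} (\<lambda>_. M)"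
  define a where "a = 100 * b / real n"
  have a: "0 < a"
    using n b by (simp add: a_def)
  define y where "y = exp (- b)"
  have y: "0 < y" "y \<le> 1 / 2"
    using b by (auto simp: y_def)
  \<comment> \<open>From index \<open>N\<close> on, the levels exceed 1 and \<open>h\<close> cannot
    attain them, so only finitely many points are needed.\<close>
  obtain N where N: "1 / a < (3 / 2) ^ N"
    using real_arch_pow[of "3 / 2" "1 / a"] by auto
  define K where "K = {k. \<exists>x. h x = a * (3 / 2) ^ k}"
  have h1: "h u \<le> 1" for u
    using h_le[of u] M.prob_le_1[of "A u"] by linarith
  have N': "1 < a * (3 / 2) ^ N"
    using N a by (simp add: field_simps)
  have KN: "K \<subseteq> {..<N}"
  proof
    fix k assume "k \<in> K"
    then obtain w where "h w = a * (3 / 2) ^ k"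
      unfolding K_def by blast
    then have "a * (3 / 2) ^ k \<le> 1"
      using h1[of w] by simp
    then have "a * (3 / 2) ^ k < a * (3 / 2) ^ N"
      using N' by linarith
    then have "(3 / 2 :: real) ^ k < (3 / 2) ^ N"
      using a by simp
    then show "k \<in> {..<N}"
      by (simp add: power_strict_increasing_iff)
  qed
  have "\<forall>k\<in>K. \<exists>x. h x = a * (3 / 2) ^ k"
    unfolding K_def by auto
  then obtain x where x: "\<And>k. k \<in> K \<Longrightarrow> h (x k) = a * (3 / 2) ^ k"
    by metis
  define bad where "bad k = {X \<in> space ?P. (\<Sum>i<n. indicator (A (x k)) (X i)) \<le> 3 / 4 * real n * h (x k)}" for k
  have [measurable]: "A u \<in> sets M" for u by fact
  have bad_sets: "bad k \<in> sets ?P" for k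
    unfolding bad_def by measurable
  have bad_le: "measure ?P (bad k) \<le> y * y ^ k" if k: "k \<in> K" for k
  proof -
    \<comment> \<open>Bernoulli turns the geometric growth of the levels into a linear lower bound
      on the exponent, so the failure probabilities decay geometrically; the factor 100/32 leaves
      room to spare.\<close>
    have "1 + real k * (1 / 2) \<le> (1 + 1 / 2) ^ k"
      by (rule Bernoulli_inequality) simp
    then have "b * (1 + real k * (1 / 2)) \<le> b * (3 / 2) ^ k"
      using b by simp
    then have "b + b * real k / 2 \<le> b * (3 / 2) ^ k"
      by (simp add: distrib_left)
    moreover have "0 \<le> b * real k"
      using b by simp
    moreover have "real n * h (x k) / 32 = 100 / 32 * (b * (3 / 2) ^ k)"
      using n by (simp add: x[OF k] a_def)
    ultimately have "b + b * real k \<le> real n * h (x k) / 32"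
      using b by linarith
    then have "exp (- (real n * h (x k) / 32)) \<le> exp (- b + real k * (- b))"
      by (simp add: algebra_simps)
    also have "\<dots> = y * y ^ k"
      unfolding y_def by (simp only: exp_add exp_of_nat_mult)
    finally show ?thesis
      using chernoff_count_lower[OF M A h_le, of n "x k"] unfolding bad_def by linarith
  qed
  have "measure ?P (\<Union>k\<in>K. bad k) \<le> (\<Sum>k\<in>K. measure ?P (bad k))"
    using KN bad_sets finite_subset by (intro measure_UNION_le) auto
  also have "\<dots> \<le> (\<Sum>k\<in>K. y * y ^ k)"
    by (intro sum_mono bad_le)
  also have "\<dots> \<le> (\<Sum>k<N. y * y ^ k)"
    using KN y by (intro sum_mono2) auto
  also have "\<dots> = y * ((1 - y ^ N) / (1 - y))"
    using y by (simp add: sum_distrib_left[symmetric] sum_gp_strict)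
  also have "\<dots> \<le> y * 2"
  proof (rule mult_left_mono)
    have "1 - y ^ N \<le> 1"
      using y by simp
    also have "1 \<le> 2 * (1 - y)"
      using y by simp
    finally show "(1 - y ^ N) / (1 - y) \<le> 2"
      using y by (simp add: divide_le_eq)
  qed (use y in simp)
  finally have small: "measure ?P (\<Union>k\<in>K. bad k) \<le> 2 * exp (- b)"
    by (simp add: y_def)
  have good: "real n * h u / 2 < (\<Sum>i<n. indicator (A u) (X i))"
    if X: "X \<in> space ?P - (\<Union>k\<in>K. bad k)" and u: "a < h u" for X u
  proof -
    have ex: "h u \<le> a * (3 / 2) ^ Suc N"
      using h1[of u] N' by simp
    \<comment> \<open>\<open>h u\<close> lies in the shell above level \<open>k\<close> and at most
      level \<open>k + 1\<close>.\<close>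
    define k where "k = (LEAST k. h u \<le> a * (3 / 2) ^ Suc k)"
    have k: "h u \<le> a * (3 / 2) ^ Suc k"
      unfolding k_def by (rule LeastI) (rule ex)
    have k': "a * (3 / 2) ^ k < h u"
    proof (cases k)
      case 0
      then show ?thesis using u by simp
    next
      case (Suc j)
      then have "\<not> h u \<le> a * (3 / 2) ^ Suc j"
        using not_less_Least[of j "\<lambda>k. h u \<le> a * (3 / 2) ^ Suc k"] by (simp add: k_def)
      then show ?thesis
        using Suc by simp
    qed
    \<comment> \<open>As \<open>h\<close> tends to 0, it falls continuously from above level
      \<open>k\<close> to below it, so the level is attained and \<open>k\<close> belongs to
      \<open>K\<close>.\<close>
    have "eventually (\<lambda>v. h v < a * (3 / 2) ^ k \<and> u \<le> v) at_top"
      using order_tendstoD(2)[OF h_lim, of "a * (3 / 2) ^ k"] a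
      by (intro eventually_conj eventually_ge_at_top) auto
    then obtain v where v: "h v < a * (3 / 2) ^ k" "u \<le> v"
      using eventually_happens by fastforce
    then obtain w where "h w = a * (3 / 2) ^ k"
      using IVT2[of h v "a * (3 / 2) ^ k" u] k' h_cont by auto
    then have kK: "k \<in> K"
      unfolding K_def by auto
    have ux: "u \<le> x k"
      using h_anti[of "x k" u] k' x[OF kK] by linarith
    \<comment> \<open>Passing from \<open>u\<close> to \<open>x k\<close> costs a factor 3/2, which
      the 3/4 in the definition of \<open>bad\<close> absorbs.\<close>
    have "real n * h u / 2 \<le> real n * (a * (3 / 2) ^ Suc k) / 2"
      using k by (intro divide_right_mono mult_left_mono) auto
    also have "\<dots> = 3 / 4 * real n * h (x k)"
      by (simp add: x[OF kK])
    also have "\<dots> < (\<Sum>i<n. indicator (A (x k)) (X i))"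
      using X kK unfolding bad_def by auto
    also have "\<dots> \<le> (\<Sum>i<n. indicator (A u) (X i))"
      using A_anti[OF ux] by (intro sum_mono) (auto simp: indicator_def)
    finally show ?thesis .
  qed
  have "(\<Union>k\<in>K. bad k) \<in> sets ?P"
    using bad_sets by blast
  then show ?thesis
    using small good unfolding a_def by blast
qed

section \<open>From tail counts to empirical quantiles\<close>

lemma quantile_ecdf_le:
  assumes "0 < n" "real n * s \<le> (\<Sum>i<n. indicator {..y} (X i))"
  shows "quantile (ecdf n X) s \<le> ereal y"
proof -
  have "s \<le> ecdf n X y"
    using assms unfolding ecdf_def by (simp add: field_simps)
  then show ?thesis
    unfolding quantile_def by (auto intro: Inf_lower)
qed

text \<open>Only sample points strictly left of \<open>y\<close> can lift the empirical cdf before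
  \<open>y\<close>, hence the open half-line.\<close>

lemma le_quantile_ecdf:
  assumes "0 < n" "(\<Sum>i<n. indicator {..<y} (X i)) < real n * s"
  shows "ereal y \<le> quantile (ecdf n X) s"
  unfolding le_quantile_iff[OF mono_ecdf]
proof (intro ballI impI)
  fix x assume "x < y"
  then have "(\<Sum>i<n. indicator {..x} (X i)) \<le> (\<Sum>i<n. indicator {..<y} (X i) :: real)"
    by (intro sum_mono) (auto simp: indicator_def)
  then have "(\<Sum>i<n. indicator {..x} (X i)) < real n * s"
    using assms(2) by linarith
  then show "ecdf n X x < s"
    using assms(1) unfolding ecdf_def by (simp add: field_simps)
qed

lemma sum_indicator_compl:
  "(\<Sum>i<n. indicator (- A) (X i)) = real n - (\<Sum>i<n. indicator A (X i))"
proof -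
  have "(\<Sum>i<n. indicator (- A) (X i)) = (\<Sum>i<n. 1 - indicator A (X i) :: real)"
    by (intro sum.cong) (auto simp: indicator_def)
  then show ?thesis
    by (simp add: sum_subtractf)
qed

text \<open>Puts every constraint, whatever \<epsilon> it comes from, within reach of
  \<open>uniform_count_lower_bound\<close>: the tail at \<open>u\<close> is above the threshold, and
  \<open>s\<close> is below half of it.\<close>

lemma CI_constraints_bounds:
  assumes cont: "\<And>x. isCont F x" and lim: "(F \<longlongrightarrow> 1) at_top"
    and n: "0 < n" and \<epsilon>max: "0 < \<epsilon>max" "\<epsilon>max < 1" and \<alpha>: "0 < \<alpha>" "\<alpha> < 1"
    and us: "(u, s) \<in> CI_constraints F \<epsilon>max \<alpha> n"
  shows "100 * ln (32 / \<alpha>) / real n < (1 - \<epsilon>max) * (1 - F u)"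
    and "s < (1 - \<epsilon>max) * (1 - F u) / 2"
proof -
  define L where "L = ln (32 / \<alpha>) / real n"
  define L4 where "L4 = ln (4 / \<alpha>) / real n"
  define d where "d = 1 - \<epsilon>max"
  have d: "0 < d" "d < 1"
    using \<epsilon>max by (auto simp: d_def)
  have "0 < ln (4 / \<alpha>)" "ln (4 / \<alpha>) \<le> ln (32 / \<alpha>)"
    using \<alpha> by (auto intro!: ln_gt_zero divide_right_mono simp: field_simps)
  then have L: "0 < L4" "L4 \<le> L"
    using n by (auto simp: L_def L4_def intro!: divide_right_mono)
  obtain \<epsilon> where \<epsilon>: "0 \<le> \<epsilon>" "rbar F \<epsilon>max \<alpha> n \<epsilon> \<noteq> \<infinity>"
    "u = t_eps F \<epsilon>max \<alpha> n \<epsilon> - real_of_ereal (rbar F \<epsilon>max \<alpha> n \<epsilon>)" "s = s_eps F \<epsilon>max \<alpha> n \<epsilon>"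
    using us unfolding CI_constraints_def by auto
  obtain r where r: "rbar F \<epsilon>max \<alpha> n \<epsilon> = ereal r"
    using \<epsilon>(2) rbar_nonneg[of F \<epsilon>max \<alpha> n \<epsilon>] by (cases "rbar F \<epsilon>max \<alpha> n \<epsilon>") auto
  define t where "t = t_eps F \<epsilon>max \<alpha> n \<epsilon>"
  have u: "u = t - r"
    using \<epsilon>(3) r by (simp add: t_def)
  have q: "d * qbar \<epsilon>max \<alpha> n \<epsilon> = 6 * \<epsilon> + 200 * (L / d)"
    unfolding qbar_def L_def d_def[symmetric] using d by (simp add: field_simps)
  have LL: "L \<le> L / d"
    using d L by (simp add: le_divide_eq mult_left_le)
  have "0 < d * qbar \<epsilon>max \<alpha> n \<epsilon>"
    using q LL L \<epsilon>(1) by linarith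
  then have "0 < qbar \<epsilon>max \<alpha> n \<epsilon>"
    using d by (simp add: zero_less_mult_iff)
  note b = t_eps_bounds[OF cont lim this r, folded t_def u]
  have "d * qbar \<epsilon>max \<alpha> n \<epsilon> \<le> d * (1 - F u)"
    using b(2) d by simp
  moreover have "6 * (1 - F t) \<le> d * (1 - F u)"
    using b(3) d unfolding d_def[symmetric] by (simp add: field_simps)
  moreover have "s = 3 / 2 * (1 - F t) + 5 / 3 * L4 + 3 / 2 * \<epsilon>"
    unfolding \<epsilon>(4) s_eps_def t_def[symmetric] L4_def by (simp add: field_simps)
  \<comment> \<open>With \<open>D = d * (1 - F u)\<close>, the third inequality bounds
    \<open>3 / 2 * (1 - F t)\<close> by \<open>D / 4\<close>, and \<open>qbar\<close> bounds
    \<open>3 / 2 * \<epsilon> + 50 * (L / d)\<close> by \<open>D / 4\<close>; the term in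
    \<open>L4\<close> is smaller than \<open>50 * (L / d)\<close>.\<close>
  ultimately have "100 * L < d * (1 - F u)" "s < d * (1 - F u) / 2"
    using q LL L \<epsilon>(1) by linarith+
  then show "100 * ln (32 / \<alpha>) / real n < (1 - \<epsilon>max) * (1 - F u)"
    "s < (1 - \<epsilon>max) * (1 - F u) / 2"
    by (simp_all add: L_def d_def)
qed

subsection \<open>Coverage and length\<close>

locale symmetric_location_model =
  fixes P0 Q :: "real measure" and F :: "real \<Rightarrow> real" and n :: nat and \<epsilon>max \<alpha> \<epsilon> \<theta> :: real
  assumes P0: "real_distribution P0" and Q: "real_distribution Q"
    and F_cdf: "F = cdf P0" and F_cont: "\<And>x. isCont F x"
    and tails: "\<And>x. measure P0 {x..} = 1 - F x" "\<And>x. measure P0 {x<..} = 1 - F x"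
      "\<And>x. measure P0 {..-x} = 1 - F x" "\<And>x. measure P0 {..<-x} = 1 - F x"
    and n: "0 < n" and \<epsilon>max: "0 < \<epsilon>max" "\<epsilon>max < 1" and \<alpha>: "0 < \<alpha>" "\<alpha> < 1"
    and \<epsilon>: "0 \<le> \<epsilon>" "\<epsilon> \<le> \<epsilon>max"
begin

sublocale P0: real_distribution P0 by (rule P0)
sublocale Q: real_distribution Q by (rule Q)

abbreviation "D \<equiv> mixture \<epsilon> (location P0 \<theta>) Q"
abbreviation "P \<equiv> PiM {..<n} (\<lambda>_. D)"

lemma location_dist: "real_distribution (location P0 \<theta>)"
  unfolding location_def by (rule P0.real_distribution_distr) simp

sublocale D: real_distribution D
  using \<epsilon> \<epsilon>max by (intro real_distribution_mixture location_dist Q) auto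

sublocale product_prob_space "\<lambda>_. D" "{..<n}"
  by standard

lemma measure_D:
  assumes "A \<in> sets borel"
  shows "measure D A = (1 - \<epsilon>) * measure P0 {x. x + \<theta> \<in> A} + \<epsilon> * measure Q A"
  using \<epsilon> \<epsilon>max assms
  by (simp add: measure_mixture[OF location_dist Q] measure_location[OF P0])

lemma F_le_1: "F x \<le> 1" and F_mono: "x \<le> y \<Longrightarrow> F x \<le> F y" and F_lim: "(F \<longlongrightarrow> 1) at_top"
  unfolding F_cdf by (simp_all add: P0.cdf_bounded_prob P0.cdf_nondecreasing P0.cdf_lim_at_top_prob)

text \<open>Contamination scales a tail down by at most \<open>1 - \<epsilon>max\<close> and adds at
  most \<epsilon>. The lower bound is free of \<epsilon> and \<open>Q\<close>, as simultaneous
  coverage requires.\<close>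

lemma measure_D_bounds:
  assumes "A \<in> sets borel" "measure P0 {x. x + \<theta> \<in> A} = 1 - F u"
  shows "(1 - \<epsilon>max) * (1 - F u) \<le> measure D A" "measure D A \<le> 1 - F u + \<epsilon>"
proof -
  have "(1 - \<epsilon>max) * (1 - F u) \<le> (1 - \<epsilon>) * (1 - F u)"
    using \<epsilon> F_le_1[of u] by (intro mult_right_mono) auto
  then show "(1 - \<epsilon>max) * (1 - F u) \<le> measure D A"
    using measure_D[OF assms(1)] assms(2) \<epsilon> by (simp add: add_increasing2)
  have "\<epsilon> * measure Q A \<le> \<epsilon> * 1"
    using \<epsilon> by (intro mult_left_mono) auto
  moreover have "0 \<le> \<epsilon> * (1 - F u)"
    using \<epsilon> F_le_1[of u] by simp
  ultimately show "measure D A \<le> 1 - F u + \<epsilon>"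
    using measure_D[OF assms(1)] assms(2) by (simp add: algebra_simps)
qed

lemma shifted_tails:
  "measure P0 {x. x + \<theta> \<in> {..\<theta> - u}} = 1 - F u" "measure P0 {x. x + \<theta> \<in> {\<theta> + u..}} = 1 - F u"
  "measure P0 {x. x + \<theta> \<in> {..<\<theta> - u}} = 1 - F u" "measure P0 {x. x + \<theta> \<in> {\<theta> + u<..}} = 1 - F u"
proof -
  have "{x. x + \<theta> \<in> {..\<theta> - u}} = {..-u}" "{x. x + \<theta> \<in> {\<theta> + u..}} = {u..}"
    "{x. x + \<theta> \<in> {..<\<theta> - u}} = {..<-u}" "{x. x + \<theta> \<in> {\<theta> + u<..}} = {u<..}"
    by auto
  then show "measure P0 {x. x + \<theta> \<in> {..\<theta> - u}} = 1 - F u" "measure P0 {x. x + \<theta> \<in> {\<theta> + u..}} = 1 - F u"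
    "measure P0 {x. x + \<theta> \<in> {..<\<theta> - u}} = 1 - F u" "measure P0 {x. x + \<theta> \<in> {\<theta> + u<..}} = 1 - F u"
    by (simp_all only: tails)
qed

lemma coverage: "1 - \<alpha> \<le> measure P {X \<in> space P. \<theta> \<in> CI F \<epsilon>max \<alpha> n X}"
proof -
  define h where "h u = (1 - \<epsilon>max) * (1 - F u)" for u
  let ?b = "ln (32 / \<alpha>)"
  have h_anti: "h v \<le> h u" if "u \<le> v" for u v
    using F_mono[OF that] \<epsilon>max unfolding h_def by (intro mult_left_mono) auto
  have h_cont: "isCont h u" for u
    unfolding h_def by (intro continuous_intros F_cont)
  have h_lim: "(h \<longlongrightarrow> 0) at_top"
    unfolding h_def using F_lim by (auto intro!: tendsto_eq_intros)
  have b: "0 < ?b" "exp (- ?b) = \<alpha> / 32"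
    using \<alpha> by (auto intro!: ln_gt_zero simp: exp_minus field_simps)
  then have b2: "exp (- ?b) \<le> 1 / 2"
    using \<alpha> by simp
  \<comment> \<open>Each side fails with probability at most \<open>2 * (\<alpha> / 32)\<close>, and
    outside the failure set all \<open>u\<close> are controlled at once.\<close>
  obtain B1 where B1: "B1 \<in> sets P" "measure P B1 \<le> 2 * exp (- ?b)"
    "\<And>X u. X \<in> space P - B1 \<Longrightarrow> 100 * ?b / real n < h u \<Longrightarrow>
       real n * h u / 2 < (\<Sum>i<n. indicator {..\<theta> - u} (X i))"
    using uniform_count_lower_bound[OF D.prob_space_axioms _ _ _ h_anti h_cont h_lim n b(1) b2,
        of "\<lambda>u. {..\<theta> - u}"]
      measure_D_bounds(1)[OF _ shifted_tails(1)] unfolding h_def by force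
  obtain B2 where B2: "B2 \<in> sets P" "measure P B2 \<le> 2 * exp (- ?b)"
    "\<And>X u. X \<in> space P - B2 \<Longrightarrow> 100 * ?b / real n < h u \<Longrightarrow>
       real n * h u / 2 < (\<Sum>i<n. indicator {\<theta> + u..} (X i))"
    using uniform_count_lower_bound[OF D.prob_space_axioms _ _ _ h_anti h_cont h_lim n b(1) b2,
        of "\<lambda>u. {\<theta> + u..}"]
      measure_D_bounds(1)[OF _ shifted_tails(2)] unfolding h_def by force
  show ?thesis
  proof (rule prob_ge_if_compl_subset[of "B1 \<union> B2"])
    show "measure P (B1 \<union> B2) \<le> \<alpha>"
      using measure_Un_le[OF B1(1) B2(1)] B1(2) B2(2) b(2) \<alpha> by simp
    show "space P - (B1 \<union> B2) \<subseteq> {X \<in> space P. \<theta> \<in> CI F \<epsilon>max \<alpha> n X}"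
    proof safe
      fix X assume X: "X \<in> space P" "X \<notin> B1" "X \<notin> B2"
      show "\<theta> \<in> CI F \<epsilon>max \<alpha> n X"
        unfolding mem_CI_iff
      proof safe
        fix u s assume us: "(u, s) \<in> CI_constraints F \<epsilon>max \<alpha> n"
        note c = CI_constraints_bounds[OF F_cont F_lim n \<epsilon>max \<alpha> us, folded h_def]
        have ns: "real n * s < real n * h u / 2"
          using c(2) n by (simp add: field_simps)
        show "quantile (ecdf n X) s \<le> ereal (\<theta> - u)"
          using B1(3)[of X u] X c(1) ns by (intro quantile_ecdf_le n) auto
        \<comment> \<open>More than \<open>n s\<close> points at or above
          \<open>\<theta> + u\<close> leave fewer than \<open>n (1 - s)\<close> strictly below
          it.\<close>
        have "real n * s < (\<Sum>i<n. indicator {\<theta> + u..} (X i))"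
          using B2(3)[of X u] X c(1) ns by auto
        then show "ereal (\<theta> + u) \<le> quantile (ecdf n X) (1 - s)"
          using sum_indicator_compl[of "{\<theta> + u..}" X n]
          by (intro le_quantile_ecdf n) (simp add: algebra_simps)
      qed
    qed
  qed (use B1 B2 measurable_mem_CI[of D] D.events_eq_borel in auto)
qed

lemma length_bound:
  "1 - \<alpha> \<le> measure P {X \<in> space P.
     enn2ereal (emeasure lborel (CI F \<epsilon>max \<alpha> n X)) \<le> 2 * rbar F \<epsilon>max \<alpha> n \<epsilon>}"
\<comment> \<open>With an infinite radius the length bound holds for every sample.\<close>
proof (cases "rbar F \<epsilon>max \<alpha> n \<epsilon> = \<infinity>")
  case True
  then show ?thesis
    using \<alpha> by (simp add: P.prob_space)
next
  case False
  then obtain r where r: "rbar F \<epsilon>max \<alpha> n \<epsilon> = ereal r" "0 \<le> r"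
    using rbar_nonneg[of F \<epsilon>max \<alpha> n \<epsilon>] by (cases "rbar F \<epsilon>max \<alpha> n \<epsilon>") auto
  define t where "t = t_eps F \<epsilon>max \<alpha> n \<epsilon>"
  define s where "s = s_eps F \<epsilon>max \<alpha> n \<epsilon>"
  let ?b = "ln (4 / \<alpha>)"
  \<comment> \<open>This identifies \<open>n s\<close> with the threshold of
    \<open>chernoff_count_upper\<close> at \<open>p = 1 - F t + \<epsilon>\<close>, so each side
    fails with probability at most \<open>\<alpha> / 4\<close>.\<close>
  have ns: "3 / 2 * (real n * (1 - F t + \<epsilon>) + 10 / 9 * ?b) = real n * s"
    unfolding s_def s_eps_def t_def[symmetric] using n by (simp add: field_simps)
  define B1 where "B1 = {X \<in> space P. real n * s \<le> (\<Sum>i<n. indicator {\<theta> + t<..} (X i))}"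
  define B2 where "B2 = {X \<in> space P. real n * s \<le> (\<Sum>i<n. indicator {..<\<theta> - t} (X i))}"
  have B: "B1 \<in> sets P" "B2 \<in> sets P"
    unfolding B1_def B2_def by measurable
  have b: "exp (- ?b) = \<alpha> / 4"
    using \<alpha> by (simp add: exp_minus)
  have "measure P B1 \<le> \<alpha> / 4" "measure P B2 \<le> \<alpha> / 4"
    using chernoff_count_upper[OF D.prob_space_axioms _ measure_D_bounds(2)[OF _ shifted_tails(4)], of t n ?b]
      chernoff_count_upper[OF D.prob_space_axioms _ measure_D_bounds(2)[OF _ shifted_tails(3)], of t n ?b]
    unfolding ns b B1_def B2_def by simp_all
  then have small: "measure P (B1 \<union> B2) \<le> \<alpha>"
    using measure_Un_le[OF B] \<alpha> by simp
  have len: "enn2ereal e \<le> 2 * rbar F \<epsilon>max \<alpha> n \<epsilon> \<longleftrightarrow> e \<le> ennreal (2 * r)" for e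
    using r by (simp add: less_eq_ennreal.rep_eq enn2ereal_ennreal)
  have "emeasure lborel (CI F \<epsilon>max \<alpha> n X) \<le> ennreal (2 * r)" if X: "X \<in> space P - (B1 \<union> B2)" for X
  proof -
    have "(\<Sum>i<n. indicator {\<theta> + t<..} (X i)) < real n * s"
      using X unfolding B1_def by auto
    then have U: "quantile (ecdf n X) (1 - s) \<le> ereal (\<theta> + t)"
      using sum_indicator_compl[of "{\<theta> + t<..}" X n]
      by (intro quantile_ecdf_le n) (simp add: algebra_simps)
    have L: "ereal (\<theta> - t) \<le> quantile (ecdf n X) s"
      using X unfolding B2_def by (intro le_quantile_ecdf n) auto
    have "CI F \<epsilon>max \<alpha> n X \<subseteq> {\<theta> - r..\<theta> + r}"
    proof
      fix x assume "x \<in> CI F \<epsilon>max \<alpha> n X"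
      then have "x \<in> CI_eps F \<epsilon>max \<alpha> n X \<epsilon>"
        using \<epsilon> unfolding CI_def by auto
      then have "quantile (ecdf n X) s \<le> ereal (x - (t - r))"
        "ereal (x + (t - r)) \<le> quantile (ecdf n X) (1 - s)"
        unfolding mem_CI_eps_iff[OF r(1)] s_def t_def by auto
      \<comment> \<open>The quantiles cancel and so does \<open>t\<close>, leaving distance at most
        \<open>r\<close> from \<open>\<theta>\<close>.\<close>
      then have "ereal (\<theta> - t) \<le> ereal (x - (t - r))" "ereal (x + (t - r)) \<le> ereal (\<theta> + t)"
        using L U order_trans by blast+
      then show "x \<in> {\<theta> - r..\<theta> + r}"
        by simp
    qed
    then have "emeasure lborel (CI F \<epsilon>max \<alpha> n X) \<le> emeasure lborel {\<theta> - r..\<theta> + r}"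
      by (intro emeasure_mono) auto
    then show ?thesis
      using r(2) by simp
  qed
  then show ?thesis
    unfolding len using small B r(2) D.events_eq_borel
    by (intro prob_ge_if_compl_subset[of "B1 \<union> B2"] measurable_length_CI) auto
qed

end

theorem corollary1:
  fixes P0 :: "real measure" and f F :: "real \<Rightarrow> real"
    and n :: nat and \<epsilon>max \<alpha> :: real
  assumes P0_prob: "prob_space P0"
    and f_meas: "f \<in> borel_measurable borel"
    and f_nonneg: "\<And>x. 0 \<le> f x"
    and P0_density: "P0 = density lborel (\<lambda>x. ennreal (f x))"
    and f_cont: "continuous_on {x. f x \<noteq> 0} f"
    and f_sym: "\<And>x. f (- x) = f x"
    and F_cdf: "F = cdf P0"
    and n: "n \<ge> 400"
    and \<epsilon>max: "0 < \<epsilon>max" "\<epsilon>max < 1"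
    and \<alpha>: "0 < \<alpha>" "\<alpha> < 1"
    and q: "qbar \<epsilon>max \<alpha> n \<epsilon>max \<le> 1"
  shows "(INF (\<epsilon>, \<theta>, Q) \<in> {0..\<epsilon>max} \<times> UNIV \<times> {Q. real_distribution Q}.
            measure (sample_law P0 n \<epsilon> \<theta> Q)
              {X \<in> space (sample_law P0 n \<epsilon> \<theta> Q). \<theta> \<in> CI F \<epsilon>max \<alpha> n X}) \<ge> 1 - \<alpha>
       \<and> (INF (\<epsilon>, \<theta>, Q) \<in> {0..\<epsilon>max} \<times> UNIV \<times> {Q. real_distribution Q}.
            measure (sample_law P0 n \<epsilon> \<theta> Q)
              {X \<in> space (sample_law P0 n \<epsilon> \<theta> Q).
                 enn2ereal (emeasure lborel (CI F \<epsilon>max \<alpha> n X)) \<le> 2 * rbar F \<epsilon>max \<alpha> n \<epsilon>}) \<ge> 1 - \<alpha>"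
proof -
  have P0: "real_distribution P0"
    using P0_prob by (simp add: real_distribution_def real_distribution_axioms_def P0_density)
  \<comment> \<open>No locale assumption mentions \<open>\<theta>\<close>, so the predicate does not
    take it and the results hold at every \<open>\<theta>\<close>.\<close>
  have model: "symmetric_location_model P0 Q F n \<epsilon>max \<alpha> \<epsilon>"
    if "real_distribution Q" "0 \<le> \<epsilon>" "\<epsilon> \<le> \<epsilon>max" for Q \<epsilon>
    unfolding F_cdf using that \<epsilon>max \<alpha> n
    by (intro symmetric_location_model.intro P0 refl
        symmetric_density_tails[of P0 f, OF P0 f_meas P0_density f_sym]) simp_all
  \<comment> \<open>A real infimum is bounded below by \<open>cINF_greatest\<close> only over a
    nonempty index set; \<open>P0\<close> itself serves as a contaminating law.\<close>
  have ne: "{0..\<epsilon>max} \<times> (UNIV :: real set) \<times> {Q. real_distribution Q} \<noteq> {}"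
    using P0 \<epsilon>max by auto
  show ?thesis
  proof (intro conjI cINF_greatest[OF ne], goal_cases)
    case (1 p)
    then obtain \<epsilon> \<theta> Q where "p = (\<epsilon>, \<theta>, Q)" "real_distribution Q" "0 \<le> \<epsilon>" "\<epsilon> \<le> \<epsilon>max"
      by auto
    then show ?case
      using symmetric_location_model.coverage[OF model, of Q \<epsilon> \<theta>] by (simp add: sample_law_def)
  next
    case (2 p)
    then obtain \<epsilon> \<theta> Q where "p = (\<epsilon>, \<theta>, Q)" "real_distribution Q" "0 \<le> \<epsilon>" "\<epsilon> \<le> \<epsilon>max"
      by auto
    then show ?case
      using symmetric_location_model.length_bound[OF model, of Q \<epsilon> \<theta>] by (simp add: sample_law_def)
  qed
qed

end
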